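(* Let $(X,d)$ be a metric space and $(Y, \varrho)$ be a linear metric space with a translation-invariant metric. Consider a point $(\bar x,\bar z) \in X\times Y$, a set-valued mapping $F:X\rightrightarrows Y$ with $\bar z\in F(\bar x)$, and a single-valued mapping $h: X \to Y$ defined and Lipschitz continuous around $\bar x$. Then $$\overline{\mathrm{sur}}(F+h)(\bar x, \bar z + h(\bar x)) \geq \overline{\mathrm{sur}}\,F(\bar x, \bar z) - \mathrm{lip}\, h (\bar x).$$
   Context: A linear metric space is a real vector space with a metric for which addition and scalar multiplication are continuous. $B_X(x,r)$, $B_Y(y,r)$ denote open balls, $\overline{C}$ the closure of $C$, and $G(M):=\bigcup_{x\in M}G(x)$. $(F+h)(x):=F(x)+h(x)$ (empty where $h$ is not defined); $h$ need only be defined in a neighborhood of $\bar x$. A set-valued mapping $G:X\rightrightarrows Y$ with $\bar y\in G(\bar x)$ is almost open with a constant $c>0$ around $(\bar x,\bar y)$ if there is a $\gamma>0$ such that $B_Y(y,ct) \cap B_Y(\bar{y}, \gamma) \subset \overline{G(B_X(x,t))}$ for each $x \in B_X(\bar{x}, \gamma)$, each $y \in G(x)$, and each $t \in (0,\gamma)$. The modulus of almost openness $\overline{\mathrm{sur}}\,G(\bar x,\bar y)$ is the supremum of all such $c>0$ (with $\sup\emptyset=0$). The mapping $h$ is Lipschitz continuous around $\bar x$ with a constant $\ell>0$ if there is an $r>0$ such that $\varrho(h(u),h(x))\le\ell\, d(u,x)$ for all $u,x\in B_X(\bar x,r)$; the Lipschitz modulus $\mathrm{lip}\,h(\bar x)$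 is the infimum of all such $\ell>0$. *)

theory Defs
  imports "HOL-Analysis.Analysis"
begin

text \<open>The class \<open>topological_monoid_add\<close> supplies joint continuity of addition; the assumption
  below is joint continuity of scalar multiplication.\<close>

class linear_metric_space = real_vector + metric_space + topological_monoid_add +
  assumes tendsto_scaleR_nhds_Pair:
    "((\<lambda>p. fst p *\<^sub>R snd p) \<longlongrightarrow> a *\<^sub>R x) (nhds a \<times>\<^sub>F nhds x)"

text \<open>A set-valued mapping from \<open>X\<close> to \<open>Y\<close> is a function into sets. The two notions below are
  meant for points with \<open>y0 \<in> G x0\<close>.\<close>

definition almost_open_around ::
  "real \<Rightarrow> ('a::metric_space \<Rightarrow> 'b::metric_space set) \<Rightarrow> 'a \<Rightarrow> 'b \<Rightarrow> bool" where
  "almost_open_around c G x0 y0 \<longleftrightarrow>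
     0 < c \<and>
     (\<exists>\<gamma>>0. \<forall>x\<in>ball x0 \<gamma>. \<forall>y\<in>G x. \<forall>t\<in>{0<..<\<gamma>}.
        ball y (c * t) \<inter> ball y0 \<gamma> \<subseteq> closure (\<Union>u\<in>ball x t. G u))"

text \<open>The inserted \<open>0\<close> realises the convention that the supremum of the empty set is \<open>0\<close>; in
  \<open>ereal\<close> it would otherwise be \<open>-\<infinity>\<close>. All other members of the set are positive.\<close>

definition almost_openness_modulus ::
  "('a::metric_space \<Rightarrow> 'b::metric_space set) \<Rightarrow> 'a \<Rightarrow> 'b \<Rightarrow> ereal" where
  "almost_openness_modulus G x0 y0 =
     Sup (insert 0 (ereal ` {c. almost_open_around c G x0 y0}))"

text \<open>A single-valued mapping defined on part of \<open>X\<close> is a total function \<open>h\<close> together with its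
  domain \<open>D\<close>; values of \<open>h\<close> outside \<open>D\<close> are never used.\<close>

definition lipschitz_around ::
  "real \<Rightarrow> 'a set \<Rightarrow> ('a::metric_space \<Rightarrow> 'b::metric_space) \<Rightarrow> 'a \<Rightarrow> bool" where
  "lipschitz_around l D h x0 \<longleftrightarrow>
     0 < l \<and> (\<exists>r>0. ball x0 r \<subseteq> D \<and> l-lipschitz_on (ball x0 r) h)"

definition lipschitz_modulus ::
  "'a set \<Rightarrow> ('a::metric_space \<Rightarrow> 'b::metric_space) \<Rightarrow> 'a \<Rightarrow> ereal" where
  "lipschitz_modulus D h x0 = Inf (ereal ` {l. lipschitz_around l D h x0})"

definition add_single_valued ::
  "('a \<Rightarrow> 'b::plus set) \<Rightarrow> 'a set \<Rightarrow> ('a \<Rightarrow> 'b) \<Rightarrow> 'a \<Rightarrow> 'b set" where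
  "add_single_valued F D h x = (if x \<in> D then (\<lambda>y. y + h x) ` F x else {})"

end

theory Submission
  imports Defs
begin

text \<open>
  Let \<open>F\<close> be almost open with constant \<open>c\<close>, let \<open>h\<close> be Lipschitz with constant \<open>l < c\<close>, and let
  \<open>w \<in> F x + h x\<close>. To approach a target \<open>y\<close>, apply almost openness of \<open>F\<close> to the shifted target
  \<open>y - h x\<close> with radius \<open>s\<close> slightly larger than \<open>dist w y / c\<close>: it yields a point \<open>u\<close> with
  \<open>dist x u < s\<close> and a \<open>w' \<in> F u + h u\<close> whose distance to \<open>y\<close> is, up to an arbitrarily small error,
  the variation \<open>l * s\<close> of \<open>h\<close>. Hence the distance to the target shrinks by a factor close to
  \<open>l / c < 1\<close>, while it decreases by at least almost \<open>(c - l) * dist x u\<close>. Since only points close to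
  \<open>y\<close> are needed, finitely many steps suffice and no completeness is required.
\<close>

lemma dist_minus_cancel:
  fixes a b c d :: "'b::linear_metric_space"
  assumes translation_invariant: "\<And>x y z :: 'b. dist (x + z) (y + z) = dist x y"
  shows "dist (a - c) b = dist a (b + c)" and "dist (d - a) (d - b) = dist a b"
proof -
  show "dist (a - c) b = dist a (b + c)"
    using translation_invariant[of "a - c" c b] by simp
  show "dist (d - a) (d - b) = dist a b"
    using translation_invariant[of "d - a" "a + b - d" "d - b"] by (simp add: dist_commute)
qed

text \<open>The potential \<open>k * dist x u + dist w y\<close> never increases along the steps and
  starts below \<open>k * t\<close>. This confines every iterate to \<open>ball x t\<close>, so
  \<open>step\<close> applies again, while the factor \<open>q\<close> drives the residual to
  zero.\<close>

lemma geometric_descent: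
  fixes G :: "'a::metric_space \<Rightarrow> 'b::metric_space set"
  assumes k: "0 < k" and q: "0 \<le> q" "q < 1"
    and start: "w0 \<in> G x" "dist w0 y < k * t"
    and step: "\<And>u w. u \<in> ball x t \<Longrightarrow> w \<in> G u \<Longrightarrow> w \<noteq> y \<Longrightarrow> dist w y < k * t \<Longrightarrow>
      \<exists>u' w'. w' \<in> G u' \<and> k * dist u u' + dist w' y \<le> dist w y \<and> dist w' y \<le> q * dist w y"
  shows "y \<in> closure (\<Union>u\<in>ball x t. G u)"
proof -
  define r where "r = dist w0 y"
  have in_ball: "u \<in> ball x t" if "k * dist x u + dist w y \<le> r" for u w
  proof -
    have "k * dist x u < k * t"
      using that start(2) zero_le_dist[of w y] unfolding r_def by linarith
    then show ?thesis
      using k by simp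
  qed
  have iterate: "\<exists>u w. w \<in> G u \<and> k * dist x u + dist w y \<le> r \<and> dist w y \<le> q ^ n * r" for n
  proof (induction n)
    case 0
    show ?case
      using start(1) by (intro exI[of _ x] exI[of _ w0]) (simp add: r_def)
  next
    case (Suc n)
    then obtain u w where uw: "w \<in> G u" "k * dist x u + dist w y \<le> r" "dist w y \<le> q ^ n * r"
      by blast
    show ?case
    proof (cases "w = y")
      case True
      then show ?thesis
        using uw q(1) by (intro exI[of _ u] exI[of _ w]) (simp add: r_def)
    next
      case False
      have "0 \<le> k * dist x u"
        using k by simp
      then have "dist w y < k * t"
        using uw(2) start(2) unfolding r_def by linarith
      then obtain u' w' where u'w': "w' \<in> G u'" "k * dist u u' + dist w' y \<le> dist w y"
          "dist w' y \<le> q * dist w y"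
        using step[OF in_ball[OF uw(2)] uw(1) False] by blast
      have "k * dist x u' \<le> k * dist x u + k * dist u u'"
        using k dist_triangle[of x u' u] by (simp flip: distrib_left)
      then have "k * dist x u' + dist w' y \<le> r"
        using uw(2) u'w'(2) by linarith
      moreover have "dist w' y \<le> q ^ Suc n * r"
        using u'w'(3) mult_left_mono[OF uw(3) q(1)] by simp
      ultimately show ?thesis
        using u'w'(1) by blast
    qed
  qed
  show ?thesis
    unfolding closure_approachable
  proof (intro allI impI)
    fix e :: real
    assume "0 < e"
    have "(\<lambda>n. q ^ n * r) \<longlonglongrightarrow> 0 * r"
      using q by (intro tendsto_intros LIMSEQ_realpow_zero)
    then have "eventually (\<lambda>n. q ^ n * r < e) sequentially"
      using \<open>0 < e\<close> by (simp add: order_tendstoD(2))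
    then obtain n where "q ^ n * r < e"
      by (auto simp: eventually_sequentially)
    moreover obtain u w where "w \<in> G u" "k * dist x u + dist w y \<le> r" "dist w y \<le> q ^ n * r"
      using iterate[of n] by blast
    ultimately have "u \<in> ball x t" "w \<in> G u" "dist w y < e"
      using in_ball by auto
    then show "\<exists>w\<in>\<Union>u\<in>ball x t. G u. dist w y < e"
      by blast
  qed
qed

lemma almost_open_around_add:
  fixes F :: "'a::metric_space \<Rightarrow> 'b::linear_metric_space set"
  assumes translation_invariant: "\<And>x y z :: 'b. dist (x + z) (y + z) = dist x y"
    and F: "almost_open_around c F xbar zbar"
    and h: "lipschitz_around l D h xbar"
    and k: "0 < k" "k < c - l"
  shows "almost_open_around k (add_single_valued F D h) xbar (zbar + h xbar)"
proof -
  note shift = dist_minus_cancel[OF translation_invariant]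
  let ?G = "add_single_valued F D h"
  obtain \<gamma> where "0 < \<gamma>" and open_F: "\<And>x y t. x \<in> ball xbar \<gamma> \<Longrightarrow> y \<in> F x \<Longrightarrow> 0 < t \<Longrightarrow> t < \<gamma> \<Longrightarrow>
      ball y (c * t) \<inter> ball zbar \<gamma> \<subseteq> closure (\<Union>u\<in>ball x t. F u)"
    using F unfolding almost_open_around_def by (metis greaterThanLessThan_iff)
  obtain r where "0 < l" "0 < r" and D: "ball xbar r \<subseteq> D" and lip: "l-lipschitz_on (ball xbar r) h"
    using h unfolding lipschitz_around_def by blast
  \<comment> \<open>Half of the gap \<open>c - l - k\<close> makes the radius exceed
    \<open>dist w y / c\<close>; the other half absorbs the approximation error left by the closure.
    The net gain is then exactly \<open>c' - l' = k\<close>.\<close>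
  define \<delta> where "\<delta> = (c - l - k) / 2"
  define c' where "c' = c - \<delta>"
  define l' where "l' = l + \<delta>"
  have bounds: "0 < \<delta>" "k = c' - l'" "c' < c" "l < l'" "0 < l'" "l' < c'" "k < c'" "0 < c'"
    using k \<open>0 < l\<close> by (auto simp: \<delta>_def c'_def l'_def field_simps)
  \<comment> \<open>Each \<open>u\<close> stays within \<open>2 * \<eta>\<close> of
    \<open>xbar\<close> and its successor within \<open>3 * \<eta>\<close>. The second bound keeps
    the shifted target \<open>y - h u\<close> within \<open>\<gamma>\<close> of \<open>zbar\<close>,
    since replacing \<open>h xbar\<close> by \<open>h u\<close> moves it by less than
    \<open>2 * (l * \<eta>)\<close>.\<close>
  define \<eta> where "\<eta> = min (min \<gamma> r / 3) (\<gamma> / (2 * l + 1))"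
  have \<eta>: "0 < \<eta>" "3 * \<eta> \<le> \<gamma>" "3 * \<eta> \<le> r"
    using \<open>0 < \<gamma>\<close> \<open>0 < r\<close> \<open>0 < l\<close> by (auto simp: \<eta>_def)
  have "\<eta> * (2 * l + 1) \<le> \<gamma>"
    using \<open>0 < l\<close> by (simp add: pos_le_divide_eq[symmetric] \<eta>_def)
  then have \<eta>_l: "2 * (l * \<eta>) + \<eta> \<le> \<gamma>"
    by (simp add: algebra_simps)
  have "y \<in> closure (\<Union>u\<in>ball x t. ?G u)"
    if x: "x \<in> ball xbar \<eta>" and w0: "w0 \<in> ?G x" and t: "0 < t" "t < \<eta>"
      and y: "y \<in> ball w0 (k * t)" "y \<in> ball (zbar + h xbar) \<eta>" for x w0 t y
  proof (rule geometric_descent[OF k(1)])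
    show "0 \<le> l' / c'" "l' / c' < 1"
      using bounds by simp_all
    show "w0 \<in> ?G x" "dist w0 y < k * t"
      using w0 y(1) by simp_all
    fix u w
    assume u: "u \<in> ball x t" and w: "w \<in> ?G u" "w \<noteq> y" "dist w y < k * t"
    have u_near: "dist xbar u < 2 * \<eta>"
      using x u t(2) dist_triangle[of xbar u x] by simp
    then have u_ball: "u \<in> ball xbar \<gamma>" "u \<in> ball xbar r"
      using \<eta> by auto
    obtain z where z: "z \<in> F u" "w = z + h u"
      using w(1) by (auto simp: add_single_valued_def split: if_splits)
    define s where "s = dist w y / c'"
    have s: "0 < s" "dist w y = c' * s"
      using w(2) bounds by (auto simp: s_def)
    have "c' * s < c' * t"
      using s(2) w(3) mult_strict_right_mono[OF bounds(7) t(1)] by linarith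
    then have "s < \<eta>"
      using t(2) bounds by simp
    have "y - h u \<in> ball z (c * s)"
      using s bounds z(2) shift(1)[of y "h u" z] by (simp add: dist_commute)
    moreover have "y - h u \<in> ball zbar \<gamma>"
    proof -
      have "dist (y - h u) (y - h xbar) \<le> l * dist u xbar"
        using lipschitz_onD[OF lip u_ball(2), of xbar] \<open>0 < r\<close> by (simp add: shift(2))
      also have "\<dots> < l * (2 * \<eta>)"
        using u_near \<open>0 < l\<close> by (simp add: dist_commute)
      finally have "dist (y - h u) (y - h xbar) < 2 * (l * \<eta>)"
        by simp
      moreover have "dist (y - h xbar) zbar < \<eta>"
        using y(2) shift(1)[of y "h xbar" zbar] by (simp add: dist_commute)
      ultimately show ?thesis
        using \<eta>_l dist_triangle[of "y - h u" zbar "y - h xbar"] by (simp add: dist_commute)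
    qed
    ultimately have "y - h u \<in> closure (\<Union>v\<in>ball u s. F v)"
      using open_F[OF u_ball(1) z(1) s(1)] \<open>s < \<eta>\<close> \<eta> by auto
    moreover have "0 < \<delta> * s"
      using s(1) bounds by simp
    ultimately obtain u' z' where u': "u' \<in> ball u s" "z' \<in> F u'" "dist z' (y - h u) < \<delta> * s"
      unfolding closure_approachable by blast
    have u'_ball: "u' \<in> ball xbar r"
      using u'(1) u_near \<open>s < \<eta>\<close> \<eta> dist_triangle[of xbar u' u] by simp
    \<comment> \<open>Passing through \<open>z' + h u\<close> separates the variation of
      \<open>h\<close>, at most \<open>l * s\<close>, from the approximation error, at most
      \<open>\<delta> * s\<close>.\<close>
    have "dist (z' + h u') y \<le> dist (z' + h u') (z' + h u) + dist (z' + h u) y"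
      by (rule dist_triangle)
    also have "dist (z' + h u') (z' + h u) = dist (h u') (h u)"
      using translation_invariant[of "h u'" z' "h u"] by (simp add: add.commute)
    also have "\<dots> \<le> l * s"
      using u'(1) \<open>0 < l\<close>
      by (intro order_trans[OF lipschitz_onD[OF lip u'_ball u_ball(2)]] mult_left_mono)
        (simp_all add: dist_commute)
    also have "dist (z' + h u) y \<le> \<delta> * s"
      using u'(3) shift(1)[of y "h u" z'] by (simp add: dist_commute)
    finally have near: "dist (z' + h u') y \<le> l' * s"
      by (simp add: l'_def distrib_right)
    show "\<exists>u' w'. w' \<in> ?G u' \<and> k * dist u u' + dist w' y \<le> dist w y \<and> dist w' y \<le> l' / c' * dist w y"
    proof (intro exI conjI)
      show "z' + h u' \<in> ?G u'"
        using u'(2) u'_ball D by (auto simp: add_single_valued_def)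
      \<comment> \<open>The two costs add up to
        \<open>(k + l') * s = c' * s = dist w y\<close>.\<close>
      have "k * dist u u' \<le> k * s"
        using u'(1) k(1) by simp
      then show "k * dist u u' + dist (z' + h u') y \<le> dist w y"
        using near unfolding s(2) bounds(2) left_diff_distrib by linarith
      show "dist (z' + h u') y \<le> l' / c' * dist w y"
        using near by (simp add: s_def)
    qed
  qed
  then show ?thesis
    unfolding almost_open_around_def using k(1) \<eta>(1) by (intro conjI exI[of _ \<eta>]) auto
qed

theorem theorem5p1:
  fixes F :: "'a::metric_space \<Rightarrow> 'b::linear_metric_space set"
    and h :: "'a \<Rightarrow> 'b"
    and D :: "'a set"
    and xbar :: 'a
    and zbar :: 'b
  assumes translation_invariant: "\<And>x y z :: 'b. dist (x + z) (y + z) = dist x y"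
    and "zbar \<in> F xbar"
    and "\<exists>l. lipschitz_around l D h xbar"
  shows "almost_openness_modulus (add_single_valued F D h) xbar (zbar + h xbar)
           \<ge> almost_openness_modulus F xbar zbar - lipschitz_modulus D h xbar"
proof -
  let ?A = "almost_openness_modulus F xbar zbar"
  let ?B = "almost_openness_modulus (add_single_valued F D h) xbar (zbar + h xbar)"
  let ?L = "lipschitz_modulus D h xbar"
  have "0 \<le> ?B"
    unfolding almost_openness_modulus_def by (rule Sup_upper) simp
  \<comment> \<open>The additive form postpones the subtraction of possibly infinite values to the
    end.\<close>
  have "?A \<le> ?B + ereal l" if l: "lipschitz_around l D h xbar" for l
  proof -
    have "0 < l"
      using l by (simp add: lipschitz_around_def)
    have "ereal c \<le> ?B + ereal l" if c: "almost_open_around c F xbar zbar" for c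
    proof -
      \<comment> \<open>Only positive constants strictly below \<open>c - l\<close> are available,
        hence the approximation from below; a nonpositive \<open>e\<close> is covered by
        \<open>0 \<le> ?B\<close>.\<close>
      have "ereal (c - l) \<le> ?B"
      proof (rule dense_le)
        fix e
        assume e: "e < ereal (c - l)"
        show "e \<le> ?B"
        proof (cases "e \<le> 0")
          case True
          then show ?thesis
            using \<open>0 \<le> ?B\<close> by (rule order_trans)
        next
          case False
          then obtain k where k: "e = ereal k" "0 < k" "k < c - l"
            using e by (cases e) auto
          then have "almost_open_around k (add_single_valued F D h) xbar (zbar + h xbar)"
            using almost_open_around_add[OF translation_invariant c l] by simp
          then show ?thesis
            unfolding almost_openness_modulus_def k(1) by (intro Sup_upper) simp
        qed
      qed
      then show ?thesis
        by (cases ?B) auto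
    qed
    then show ?thesis
      using \<open>0 \<le> ?B\<close> \<open>0 < l\<close> unfolding almost_openness_modulus_def[of F]
      by (intro Sup_least) (auto intro: add_nonneg_nonneg)
  qed
  \<comment> \<open>The remaining case is \<open>?B = \<infinity>\<close>, where the claim is
    trivial.\<close>
  then have "?A - ?B \<le> ?L" if "\<bar>?B\<bar> \<noteq> \<infinity>"
    unfolding lipschitz_modulus_def using that
    by (intro Inf_greatest) (auto simp: ereal_minus_le add.commute)
  \<comment> \<open>\<open>?L\<close> has to be finite: for \<open>?L = -\<infinity>\<close>, and
    also for \<open>?A = ?L = \<infinity>\<close>, the difference \<open>?A - ?L\<close> would be
    \<open>\<infinity>\<close> in \<open>ereal\<close>.\<close>
  moreover have "0 \<le> ?L"
    unfolding lipschitz_modulus_def lipschitz_around_def by (auto intro!: Inf_greatest)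
  moreover obtain l where "?L \<le> ereal l"
    using assms(3) unfolding lipschitz_modulus_def by (blast intro: Inf_lower)
  ultimately show ?thesis
    using \<open>0 \<le> ?B\<close> by (cases ?A; cases ?B; cases ?L) auto
qed

end
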